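(* For a finite skew left brace $B$, $\mathrm{Pb}(B)=\frac{5}{8}$ if and only if $|B/\mathrm{Ann}(B)|=4$ and $|\mathrm{Cb}_B(x)|=\frac{|B|}{2}$ for all $x\in B\setminus\mathrm{Ann}(B)$.
   Context: A skew left brace is a set $B$ with two group structures $(B,+)$ and $(B,\circ)$ (neither assumed abelian) such that $a\circ(b+c)=(a\circ b)-a+(a\circ c)$ for all $a,b,c\in B$, where $-a$ is the inverse of $a$ in $(B,+)$. The identities of the two groups coincide and are denoted by $1$. Put $a*b:=-a+(a\circ b)-b$ and $[a,b]^+:=a+b-a-b$. The annihilator of $B$ is $\mathrm{Ann}(B):=\{a\in B\mid a+b=b+a=a\circ b=b\circ a \text{ for all } b\in B\}$; it is an ideal of $B$, so $B/\mathrm{Ann}(B)$ is a quotient skew brace. The brace centralizer of $x\in B$ is $\mathrm{Cb}_B(x):=\{b\in B\mid x*b=b*x=[x,b]^+=1\}$. For a finite skew left brace $B$, the commuting probability is $$\mathrm{Pb}(B):=\frac{1}{|B|^2}\,\bigl|\{(a,b)\in B\times B \mid a*b=b*a=[a,b]^+=1\}\bigr|.$$ *)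

theory Defs
  imports Complex_Main "HOL-Algebra.QuotRing"
begin

text \<open>
  A skew left brace is carried by the library's ring record: \<open>\<oplus>\<close> is the (not necessarily
  commutative) operation \<open>+\<close>, and \<open>\<otimes>\<close> is the circle operation. No ring axiom is assumed.
\<close>

locale skew_left_brace =
  fixes B (structure)
  assumes add_group: "group (add_monoid B)"
    and circ_group: "group B"
    and brace_compat: "\<lbrakk>a \<in> carrier B; b \<in> carrier B; c \<in> carrier B\<rbrakk>
      \<Longrightarrow> a \<otimes> (b \<oplus> c) = ((a \<otimes> b) \<ominus> a) \<oplus> (a \<otimes> c)"

lemma (in skew_left_brace) zero_eq_one: "\<zero> = \<one>"
proof -
  interpret A: group "add_monoid B" by (rule add_group)
  interpret M: group B by (rule circ_group)
  have z: "\<zero> \<in> carrier B" using A.one_closed by simp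
  have "\<one> \<otimes> (\<zero> \<oplus> \<zero>) = ((\<one> \<otimes> \<zero>) \<ominus> \<one>) \<oplus> (\<one> \<otimes> \<zero>)"
    using z by (intro brace_compat) simp_all
  moreover have "\<zero> \<oplus> \<zero> = \<zero>" using A.l_one A.one_closed by simp
  ultimately have e: "\<zero> = (\<zero> \<ominus> \<one>) \<oplus> \<zero>" using z by simp
  have i: "\<ominus> \<one> \<in> carrier B" using A.inv_closed by (simp add: a_inv_def)
  have "\<zero> = \<ominus> \<one>" using e i A.r_one A.l_one by (simp add: a_minus_def)
  then have "\<one> \<oplus> \<zero> = \<one> \<oplus> (\<ominus> \<one>)" by simp
  then show ?thesis using A.r_inv[of \<one>] A.r_one[of \<one>] by (simp add: a_inv_def)
qed

definition brace_star :: "('a, 'm) ring_scheme \<Rightarrow> 'a \<Rightarrow> 'a \<Rightarrow> 'a" where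
  "brace_star B a b = (\<ominus>\<^bsub>B\<^esub> a \<oplus>\<^bsub>B\<^esub> (a \<otimes>\<^bsub>B\<^esub> b)) \<ominus>\<^bsub>B\<^esub> b"

definition add_commutator :: "('a, 'm) ring_scheme \<Rightarrow> 'a \<Rightarrow> 'a \<Rightarrow> 'a" where
  "add_commutator B a b = ((a \<oplus>\<^bsub>B\<^esub> b) \<ominus>\<^bsub>B\<^esub> a) \<ominus>\<^bsub>B\<^esub> b"

definition brace_Ann :: "('a, 'm) ring_scheme \<Rightarrow> 'a set" where
  "brace_Ann B = {a \<in> carrier B. \<forall>b \<in> carrier B.
     a \<oplus>\<^bsub>B\<^esub> b = b \<oplus>\<^bsub>B\<^esub> a \<and> b \<oplus>\<^bsub>B\<^esub> a = a \<otimes>\<^bsub>B\<^esub> b \<and> a \<otimes>\<^bsub>B\<^esub> b = b \<otimes>\<^bsub>B\<^esub> a}"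

definition brace_Cb :: "('a, 'm) ring_scheme \<Rightarrow> 'a \<Rightarrow> 'a set" where
  "brace_Cb B x = {b \<in> carrier B.
     brace_star B x b = \<one>\<^bsub>B\<^esub> \<and> brace_star B b x = \<one>\<^bsub>B\<^esub> \<and> add_commutator B x b = \<one>\<^bsub>B\<^esub>}"

definition brace_Pb :: "('a, 'm) ring_scheme \<Rightarrow> real" where
  "brace_Pb B = 1 / (real (order B))\<^sup>2 *
     real (card {(a, b). a \<in> carrier B \<and> b \<in> carrier B \<and>
       brace_star B a b = \<one>\<^bsub>B\<^esub> \<and> brace_star B b a = \<one>\<^bsub>B\<^esub> \<and> add_commutator B a b = \<one>\<^bsub>B\<^esub>})"

text \<open>
  The library constant \<open>Quot\<close> is defined on bare ring records: the elements of \<open>B Quot I\<close> are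
  the additive cosets of \<open>I\<close>, with both operations induced from \<open>B\<close>. For an ideal \<open>I\<close> of a
  skew left brace (in particular for the annihilator) this is the quotient skew left brace.
\<close>

abbreviation brace_Ann_quotient :: "('a, 'm) ring_scheme \<Rightarrow> 'a set ring" where
  "brace_Ann_quotient B \<equiv> B Quot brace_Ann B"

end

theory Submission
  imports Defs "HOL-Computational_Algebra.Primes"
begin

text \<open>
  The pairs counted by \<open>brace_Pb B\<close> are the pairs \<open>(x, b)\<close> with \<open>b \<in> brace_Cb B x\<close>, so
  \<open>|B|\<^sup>2 Pb(B) = \<Sum>\<^sub>x |Cb(x)|\<close>. Membership of \<open>b\<close> in \<open>Cb(x)\<close> means that \<open>x\<close> and \<open>b\<close> have one
  common value for the four products \<open>x + b\<close>, \<open>b + x\<close>, \<open>x \<circ> b\<close>, \<open>b \<circ> x\<close>. Closure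
  of \<open>Cb(x)\<close> under \<open>+\<close> is not apparent, but the brace axiom makes it a subgroup of the
  \<^emph>\<open>circle\<close> group (lemmas \<open>Cb_mult_closed\<close> and \<open>Cb_subgroup\<close>). The annihilator is a
  subgroup for both operations (lemma \<open>Ann_subgroups\<close>); it is contained in every \<open>Cb(x)\<close>,
  and \<open>Cb(x)\<close> is all of \<open>B\<close> exactly for \<open>x\<close> in it.

  Put \<open>n = |B|\<close> and \<open>z = |Ann(B)|\<close>. Lagrange's theorem gives \<open>|Cb(x)| \<le> n/2\<close> outside the
  annihilator (lemma \<open>card_Cb_le_half\<close>), whence
  \<open>n\<^sup>2 Pb(B) \<le> n z + (n - z) n/2\<close>, with equality exactly if every such \<open>Cb(x)\<close> has order \<open>n/2\<close>.
  For \<open>n = 4 z\<close> the right-hand side is \<open>5 n\<^sup>2/8\<close>, which settles the case of index 4 in both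
  directions. If \<open>Pb(B) = 5/8\<close> then the inequality gives \<open>n \<le> 4 z\<close>, and index at most 3 is
  excluded by computing \<open>Pb(B)\<close>: since the index of \<open>Ann(B)\<close> is 1 or a prime, \<open>Cb(x)\<close>, lying
  between \<open>Ann(B)\<close> and \<open>B\<close> in the circle group, is one of the two (lemma
  \<open>card_Cb_of_prime_index\<close>), and \<open>Pb(B)\<close> is 1, 3/4 or 5/9. Prime index
  cannot be ruled out outright, as it is for the centre of a group, because an element need not lie in its own centralizer: on the integers modulo 4
  with \<open>a \<circ> b = a + b + 2 a b\<close>, the annihilator \<open>{0, 2}\<close> has index 2.
\<close>

context skew_left_brace
begin

interpretation A: group "add_monoid B"
  rewrites "carrier (add_monoid B) = carrier B"
    and "monoid.mult (add_monoid B) = add B"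
    and "monoid.one (add_monoid B) = \<one>"
    and "m_inv (add_monoid B) = a_inv B"
  by (rule add_group) (simp_all add: zero_eq_one a_inv_def)

interpretation M: group B
  by (rule circ_group)

lemma brace_star_eq_one_iff:
  assumes "a \<in> carrier B" "b \<in> carrier B"
  shows "brace_star B a b = \<one> \<longleftrightarrow> a \<otimes> b = a \<oplus> b"
proof -
  have "brace_star B a b = \<one> \<longleftrightarrow> \<ominus> a \<oplus> a \<otimes> b = b"
    using assms A.inv_solve_right[of \<one> "\<ominus> a \<oplus> a \<otimes> b" b]
    by (auto simp: brace_star_def a_minus_def A.r_inv A.l_one eq_commute[of \<one>])
  also have "\<dots> \<longleftrightarrow> a \<otimes> b = a \<oplus> b"
    using assms A.inv_solve_left[of b a "a \<otimes> b"] by auto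
  finally show ?thesis .
qed

lemma add_commutator_eq_one_iff:
  assumes "a \<in> carrier B" "b \<in> carrier B"
  shows "add_commutator B a b = \<one> \<longleftrightarrow> a \<oplus> b = b \<oplus> a"
proof -
  have "add_commutator B a b = \<one> \<longleftrightarrow> (a \<oplus> b) \<oplus> \<ominus> a = b"
    using assms A.inv_solve_right[of \<one> "(a \<oplus> b) \<oplus> \<ominus> a" b]
    by (auto simp: add_commutator_def a_minus_def A.r_inv A.l_one eq_commute[of \<one>])
  also have "\<dots> \<longleftrightarrow> a \<oplus> b = b \<oplus> a"
    using assms A.inv_solve_right[of b "a \<oplus> b" a] by auto
  finally show ?thesis .
qed

lemma mem_Cb_iff:
  assumes "x \<in> carrier B"
  shows "b \<in> brace_Cb B x \<longleftrightarrow>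
    b \<in> carrier B \<and> x \<otimes> b = x \<oplus> b \<and> b \<otimes> x = b \<oplus> x \<and> x \<oplus> b = b \<oplus> x"
  using assms by (auto simp: brace_Cb_def brace_star_eq_one_iff add_commutator_eq_one_iff)

lemma mem_Cb_commute:
  assumes "x \<in> carrier B" "y \<in> carrier B"
  shows "y \<in> brace_Cb B x \<longleftrightarrow> x \<in> brace_Cb B y"
  unfolding mem_Cb_iff[OF assms(1)] mem_Cb_iff[OF assms(2)] using assms by metis

lemma Cb_subset: "brace_Cb B x \<subseteq> carrier B"
  by (auto simp: brace_Cb_def)

lemma mem_Ann_iff:
  "a \<in> brace_Ann B \<longleftrightarrow> a \<in> carrier B \<and> brace_Cb B a = carrier B"
proof (cases "a \<in> carrier B")
  case True
  then have "brace_Cb B a = carrier B \<longleftrightarrow> (\<forall>b\<in>carrier B. b \<in> brace_Cb B a)"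
    using Cb_subset by blast
  also have "\<dots> \<longleftrightarrow> a \<in> brace_Ann B"
    using True by (auto simp: brace_Ann_def mem_Cb_iff)
  finally show ?thesis using True by simp
qed (simp add: brace_Ann_def)

lemma Ann_subset_Cb:
  assumes "x \<in> carrier B"
  shows "brace_Ann B \<subseteq> brace_Cb B x"
  using assms by (auto simp: brace_Ann_def mem_Cb_iff)

text \<open>
  For \<open>b\<close>, \<open>c\<close> in \<open>Cb(x)\<close>, moving \<open>x\<close> across \<open>b\<close> in the circle group and then expanding
  \<open>b \<circ> (x + c)\<close> by the brace axiom gives \<open>x \<circ> (b \<circ> c) = x + b \<circ> c\<close>; expanding
  \<open>b \<circ> (c + x)\<close> gives the mirror image.
\<close>
lemma Cb_mult_closed:
  assumes x: "x \<in> carrier B" and b: "b \<in> brace_Cb B x" and c: "c \<in> brace_Cb B x"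
  shows "b \<otimes> c \<in> brace_Cb B x"
proof -
  have bB: "b \<in> carrier B" and cB: "c \<in> carrier B"
    and bx: "x \<otimes> b = x \<oplus> b" "b \<otimes> x = b \<oplus> x" "x \<oplus> b = b \<oplus> x"
    and cx: "x \<otimes> c = x \<oplus> c" "c \<otimes> x = c \<oplus> x" "x \<oplus> c = c \<oplus> x"
    using b c x by (simp_all add: mem_Cb_iff)
  have comm: "x \<otimes> (b \<otimes> c) = b \<otimes> (x \<otimes> c)" "x \<otimes> c = c \<otimes> x"
    using x bB cB bx cx M.m_assoc[of x b c] M.m_assoc[of b x c] by auto
  have "b \<otimes> (x \<oplus> c) = (x \<oplus> b \<ominus> b) \<oplus> b \<otimes> c"
    using x bB cB bx brace_compat by simp
  then have left: "x \<otimes> (b \<otimes> c) = x \<oplus> b \<otimes> c"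
    using x bB cB comm cx by (simp add: a_minus_def A.m_assoc)
  have "b \<otimes> (c \<oplus> x) = (b \<otimes> c \<ominus> b) \<oplus> (b \<oplus> x)"
    using x bB cB bx brace_compat by simp
  then have right: "(b \<otimes> c) \<otimes> x = b \<otimes> c \<oplus> x"
    using x bB cB cx A.m_assoc[of "\<ominus> b" b x]
    by (simp add: a_minus_def A.m_assoc M.m_assoc A.l_inv A.l_one)
  have "x \<otimes> (b \<otimes> c) = (b \<otimes> c) \<otimes> x"
    using x bB cB comm by (simp add: M.m_assoc)
  with left right show ?thesis
    using x bB cB by (simp add: mem_Cb_iff)
qed

text \<open>
  Inverses: \<open>a \<circ> (x + a\<inverse>) = a \<circ> x - a = x\<close> and \<open>a \<circ> (a\<inverse> + x) = - a + a \<circ> x = x\<close>, where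
  \<open>a\<inverse>\<close> is the circle inverse, so both \<open>x + a\<inverse>\<close> and \<open>a\<inverse> + x\<close> equal \<open>a\<inverse> \<circ> x\<close>.
\<close>
lemma Cb_subgroup:
  assumes x: "x \<in> carrier B"
  shows "subgroup (brace_Cb B x) B"
proof (rule M.subgroupI)
  show "brace_Cb B x \<subseteq> carrier B" by (rule Cb_subset)
  have "\<one> \<in> brace_Cb B x"
    using x A.l_one A.r_one by (simp add: mem_Cb_iff)
  then show "brace_Cb B x \<noteq> {}" by blast
  fix a assume a: "a \<in> brace_Cb B x"
  then have aB: "a \<in> carrier B" and ax: "x \<otimes> a = x \<oplus> a" "a \<otimes> x = a \<oplus> x" "x \<oplus> a = a \<oplus> x"
    using x by (simp_all add: mem_Cb_iff)
  have "a \<otimes> (x \<oplus> inv a) = (x \<oplus> a \<ominus> a) \<oplus> a \<otimes> inv a"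
    using brace_compat[of a x "inv a"] aB x ax by simp
  then have "a \<otimes> (x \<oplus> inv a) = x"
    using aB x by (simp add: a_minus_def A.m_assoc A.r_inv A.r_one)
  then have right: "x \<oplus> inv a = inv a \<otimes> x"
    using aB x M.inv_solve_left[of "x \<oplus> inv a" a x] by simp
  have "a \<otimes> (inv a \<oplus> x) = (a \<otimes> inv a \<ominus> a) \<oplus> (a \<oplus> x)"
    using brace_compat[of a "inv a" x] aB x ax by simp
  then have "a \<otimes> (inv a \<oplus> x) = x"
    using aB x A.m_assoc[of "\<ominus> a" a x] by (simp add: a_minus_def A.l_inv A.l_one)
  then have left: "inv a \<oplus> x = inv a \<otimes> x"
    using aB x M.inv_solve_left[of "inv a \<oplus> x" a x] by simp
  have "a \<otimes> x = x \<otimes> a" using ax by simp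
  then have "inv a \<otimes> x = x \<otimes> inv a"
    using aB x by (metis M.inv_closed M.inv_solve_left M.inv_solve_right M.m_assoc M.m_closed)
  then show "inv a \<in> brace_Cb B x"
    using left right aB x by (simp add: mem_Cb_iff)
  fix b assume "b \<in> brace_Cb B x"
  then show "a \<otimes> b \<in> brace_Cb B x" by (rule Cb_mult_closed[OF x a])
qed

text \<open>
  On the annihilator both operations agree, so closure under \<open>\<circ>\<close>, inherited from the
  subgroups \<open>Cb(x)\<close> whose intersection it is, also gives closure under \<open>+\<close>.
\<close>
lemma Ann_subgroups:
  shows "subgroup (brace_Ann B) B" and "subgroup (brace_Ann B) (add_monoid B)"
proof -
  have "brace_Ann B = (\<Inter>x\<in>carrier B. brace_Cb B x)"
  proof (intro equalityI subsetI)
    fix a assume "a \<in> brace_Ann B"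
    then show "a \<in> (\<Inter>x\<in>carrier B. brace_Cb B x)" using Ann_subset_Cb by blast
  next
    fix a assume a: "a \<in> (\<Inter>x\<in>carrier B. brace_Cb B x)"
    then have aB: "a \<in> carrier B" using Cb_subset M.one_closed by blast
    have "b \<in> brace_Cb B a" if "b \<in> carrier B" for b
      using a that mem_Cb_commute[OF aB that] by blast
    then have "brace_Cb B a = carrier B" using Cb_subset by (intro equalityI subsetI) auto
    then show "a \<in> brace_Ann B" using aB by (simp add: mem_Ann_iff)
  qed
  moreover have "subgroup (\<Inter>x\<in>carrier B. brace_Cb B x) B"
  proof (rule M.subgroups_Inter)
    show "brace_Cb B ` carrier B \<noteq> {}" using M.one_closed by blast
    show "subgroup H B" if "H \<in> brace_Cb B ` carrier B" for H
      using that Cb_subgroup by blast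
  qed
  ultimately show sub: "subgroup (brace_Ann B) B" by simp
  have add_eq: "a \<oplus> b = a \<otimes> b" if "a \<in> brace_Ann B" "b \<in> brace_Ann B" for a b
  proof -
    have "a \<in> carrier B" "b \<in> brace_Cb B a"
      using that Ann_subset_Cb mem_Ann_iff by blast+
    then show ?thesis by (simp add: mem_Cb_iff)
  qed
  have one: "\<one> \<in> brace_Ann B"
    using sub by (rule subgroup.one_closed)
  show "subgroup (brace_Ann B) (add_monoid B)"
  proof (rule A.subgroupI)
    show "brace_Ann B \<subseteq> carrier B" using sub by (rule subgroup.subset)
    show "brace_Ann B \<noteq> {}" using one by blast
    fix a assume a: "a \<in> brace_Ann B"
    then have aB: "a \<in> carrier B" and ia: "inv a \<in> brace_Ann B"
      using subgroup.m_inv_closed[OF sub] subgroup.mem_carrier[OF sub] by blast+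
    then have "inv a \<oplus> a = \<one>" using a aB add_eq by (metis M.l_inv)
    then have "\<ominus> a = inv a"
      using aB A.inv_equality[of "inv a" a] by simp
    then show "\<ominus> a \<in> brace_Ann B" using ia by simp
    fix b assume b: "b \<in> brace_Ann B"
    then show "a \<oplus> b \<in> brace_Ann B"
      using a add_eq subgroup.m_closed[OF sub a b] by simp
  qed
qed

text \<open>
  The elements of the quotient are additive cosets, so this needs Lagrange's theorem in the
  additive group, whereas the centralizers are compared with the annihilator in the circle
  group.
\<close>
lemma order_Ann_quotient: "order B = order (brace_Ann_quotient B) * card (brace_Ann B)"
  using A.lagrange[OF Ann_subgroups(2)]
  by (simp add: order_def FactRing_def A_RCOSETS_def)

text \<open>
  Outside the annihilator \<open>Cb(x)\<close> is a proper subgroup of the circle group, so its index is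
  at least 2.
\<close>
lemma card_Cb_le_half:
  assumes fin: "finite (carrier B)" and x: "x \<in> carrier B - brace_Ann B"
  shows "2 * card (brace_Cb B x) \<le> order B"
proof -
  let ?r = "card (rcosets (brace_Cb B x))"
  have lag: "?r * card (brace_Cb B x) = order B"
    using Cb_subgroup x by (intro M.lagrange) auto
  have "brace_Cb B x \<noteq> carrier B" using x mem_Ann_iff by blast
  then have "card (brace_Cb B x) \<noteq> order B"
    using fin Cb_subset card_subset_eq unfolding order_def by blast
  moreover have "order B > 0" using fin M.order_gt_0_iff_finite by blast
  ultimately have "?r \<noteq> 1" "?r \<noteq> 0" using lag by (auto intro: gr0I)
  then have "2 \<le> ?r" by linarith
  then show ?thesis using lag mult_le_mono1 by metis
qed

text \<open>
  A proper subgroup of the circle group that contains a subgroup of prime index equals it.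
\<close>
lemma card_Cb_of_prime_index:
  assumes fin: "finite (carrier B)" and p: "prime p"
    and n: "order B = p * card (brace_Ann B)" and x: "x \<in> carrier B - brace_Ann B"
  shows "card (brace_Cb B x) = card (brace_Ann B)"
proof -
  let ?C = "brace_Cb B x"
  have sub: "subgroup ?C B" using Cb_subgroup x by blast
  have "subgroup (brace_Ann B) (B\<lparr>carrier := ?C\<rparr>)"
    using Ann_subgroups(1) sub Ann_subset_Cb x by (intro M.subgroup_incl) auto
  then have "card ?C = card (rcosets\<^bsub>B\<lparr>carrier := ?C\<rparr>\<^esub> (brace_Ann B)) * card (brace_Ann B)"
    using group.lagrange[OF M.subgroup_imp_group[OF sub]] by (simp add: order_def)
  then obtain m where m: "card ?C = m * card (brace_Ann B)" by blast
  have pos: "order B > 0" using fin M.order_gt_0_iff_finite by blast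
  have "card ?C dvd order B"
    by (subst M.lagrange[OF sub, symmetric]) simp
  then have "m dvd p" using m n pos by simp
  moreover have "m \<noteq> p" using card_Cb_le_half[OF fin x] m n pos by simp
  ultimately have "m = 1" using p by (auto simp: prime_nat_iff)
  then show ?thesis using m by simp
qed

text \<open>
  The commuting pairs are counted by their first component; each element of the annihilator
  contributes all of \<open>B\<close>.
\<close>
lemma Pb_eq_sum_card_Cb:
  assumes fin: "finite (carrier B)"
  shows "brace_Pb B * (real (order B))\<^sup>2 = real (card (brace_Ann B)) * real (order B)
    + (\<Sum>x\<in>carrier B - brace_Ann B. real (card (brace_Cb B x)))"
proof -
  let ?P = "{(a, b). a \<in> carrier B \<and> b \<in> carrier B \<and>
    brace_star B a b = \<one> \<and> brace_star B b a = \<one> \<and> add_commutator B a b = \<one>}"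
  have "?P = Sigma (carrier B) (brace_Cb B)"
    by (auto simp: brace_Cb_def)
  moreover have "finite (brace_Cb B x)" for x
    using fin Cb_subset finite_subset by blast
  ultimately have "card ?P = (\<Sum>x\<in>carrier B. card (brace_Cb B x))"
    using fin by simp
  moreover have "order B > 0" using fin M.order_gt_0_iff_finite by blast
  ultimately have "brace_Pb B * (real (order B))\<^sup>2 = (\<Sum>x\<in>carrier B. real (card (brace_Cb B x)))"
    by (simp add: brace_Pb_def)
  also have "\<dots> = (\<Sum>x\<in>carrier B - brace_Ann B. real (card (brace_Cb B x)))
      + (\<Sum>x\<in>brace_Ann B. real (card (brace_Cb B x)))"
    using fin by (intro sum.subset_diff) (auto simp: brace_Ann_def)
  also have "(\<Sum>x\<in>brace_Ann B. real (card (brace_Cb B x))) = (\<Sum>x\<in>brace_Ann B. real (order B))"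
    by (intro sum.cong) (auto simp: mem_Ann_iff order_def)
  finally show ?thesis by simp
qed

end

theorem lemma3p9:
  fixes B :: "('a, 'm) ring_scheme"
  assumes "skew_left_brace B" and "finite (carrier B)"
  shows "brace_Pb B = 5 / 8 \<longleftrightarrow>
    order (brace_Ann_quotient B) = 4 \<and>
    (\<forall>x \<in> carrier B - brace_Ann B. real (card (brace_Cb B x)) = real (order B) / 2)"
proof -
  interpret skew_left_brace B by fact
  note fin = assms(2)
  define n z k where "n = real (order B)" and "z = real (card (brace_Ann B))"
    and "k = order (brace_Ann_quotient B)"
  define S where "S = (\<Sum>x\<in>carrier B - brace_Ann B. real (card (brace_Cb B x)))"
  have nkz: "order B = k * card (brace_Ann B)"
    unfolding k_def by (rule order_Ann_quotient)
  then have n: "n = real k * z" by (simp add: n_def z_def)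
  have n0: "n > 0"
    using fin group.is_monoid[OF circ_group] monoid.one_closed
    by (fastforce simp: n_def order_def card_gt_0_iff)
  have z0: "z > 0" using n n0 by (auto simp: z_def zero_less_mult_iff)
  have card_compl: "real (card (carrier B - brace_Ann B)) = n - z"
    using fin card_mono[OF fin, of "brace_Ann B"]
    by (subst card_Diff_subset)
      (auto simp: n_def z_def order_def brace_Ann_def of_nat_diff intro: finite_subset)
  have const: "S = (n - z) * c" if "\<forall>x\<in>carrier B - brace_Ann B. real (card (brace_Cb B x)) = c" for c
    using that card_compl by (simp add: S_def)
  have Pb: "brace_Pb B = 5 / 8 \<longleftrightarrow> z * n + S = 5 / 8 * n\<^sup>2"
  proof -
    have "brace_Pb B = 5 / 8 \<longleftrightarrow> brace_Pb B * n\<^sup>2 = 5 / 8 * n\<^sup>2" using n0 by simp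
    then show ?thesis using Pb_eq_sum_card_Cb[OF fin] by (simp add: S_def n_def z_def)
  qed
  have half: "real (card (brace_Cb B x)) \<le> n / 2" if "x \<in> carrier B - brace_Ann B" for x
    using card_Cb_le_half[OF fin that] by (simp add: n_def)
  have S_le: "S \<le> (n - z) * (n / 2)"
    using sum_mono[OF half, of "carrier B - brace_Ann B" "\<lambda>x. x"] card_compl by (simp add: S_def)
  show ?thesis
  proof (intro iffI; (elim conjE)?)
    assume "order (brace_Ann_quotient B) = 4"
      and "\<forall>x\<in>carrier B - brace_Ann B. real (card (brace_Cb B x)) = real (order B) / 2"
    then have "n = 4 * z" "S = (n - z) * (n / 2)"
      using n const[of "n / 2"] by (simp_all add: k_def n_def)
    then show "brace_Pb B = 5 / 8"
      unfolding Pb by (simp add: power2_eq_square)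
  next
    assume "brace_Pb B = 5 / 8"
    then have eq: "z * n + S = 5 / 8 * n\<^sup>2" using Pb by simp
    then have "n * (5 / 8 * n) \<le> n * (z + (n - z) / 2)"
      using S_le by (simp add: power2_eq_square field_simps)
    then have "5 / 8 * n \<le> z + (n - z) / 2" using n0 by (simp only: mult_le_cancel_left_pos)
    then have "n \<le> 4 * z" by argo
    then have "k \<le> 4" using n z0 by simp
    moreover have "k \<noteq> 0" using n n0 by (metis mult_zero_left of_nat_0 less_irrefl)
    moreover have "k \<noteq> 1"
    proof
      assume "k = 1"
      then have "n = z" using n by simp
      moreover have "S \<ge> 0" unfolding S_def by (intro sum_nonneg) simp
      ultimately have "S = 0" using S_le by simp
      with \<open>n = z\<close> show False using eq n0 by (simp add: power2_eq_square)
    qed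
    moreover have "\<not> prime k"
    proof
      assume "prime k"
      then have "S = (n - z) * z"
        using card_Cb_of_prime_index[OF fin _ nkz] by (intro const) (simp add: z_def)
      then have "z\<^sup>2 * (2 * real k - 1) = z\<^sup>2 * (5 / 8 * (real k)\<^sup>2)"
        using eq n by (simp add: power2_eq_square algebra_simps)
      then have k_eq: "2 * real k - 1 = 5 / 8 * (real k)\<^sup>2" using z0 by simp
      \<comment> \<open>The equation \<open>5 k\<^sup>2 - 16 k + 8 = 0\<close> has no integer solution.\<close>
      have "k = 1 \<or> k = 2 \<or> k = 3 \<or> k = 4"
        using \<open>k \<le> 4\<close> \<open>k \<noteq> 0\<close> by linarith
      then show False using k_eq by auto
    qed
    moreover have "prime (3::nat)"
    proof -
      have "{2..<3} = {2::nat}" by auto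
      then show ?thesis by (simp add: prime_nat_iff')
    qed
    then have "k \<noteq> 2" "k \<noteq> 3"
      using \<open>\<not> prime k\<close> two_is_prime_nat by auto
    ultimately have k4: "k = 4" by linarith
    then have "S = (n - z) * (n / 2)"
      using eq n by (simp add: power2_eq_square algebra_simps)
    \<comment> \<open>The upper bound for \<open>S\<close> is attained, so each of its summands is.\<close>
    then have "(\<Sum>x\<in>carrier B - brace_Ann B. n / 2 - real (card (brace_Cb B x))) = 0"
      using card_compl by (simp add: sum_subtractf S_def)
    then have "\<forall>x\<in>carrier B - brace_Ann B. n / 2 - real (card (brace_Cb B x)) = 0"
      using half fin by (subst (asm) sum_nonneg_eq_0_iff) auto
    then show "order (brace_Ann_quotient B) = 4 \<and>
      (\<forall>x\<in>carrier B - brace_Ann B. real (card (brace_Cb B x)) = real (order B) / 2)"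
      using k4 by (auto simp: k_def n_def)
  qed
qed

end
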